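(* Let $\tilde q_1,\dots,\tilde q_r$ be pairwise different integers such that each $|\tilde q_i|$ is an odd prime and $\tilde q_i\equiv1\pmod4$. Let $\alpha_i=\frac{1+\sqrt{\tilde q_i}}2$ and $\tilde\alpha_i=\frac{1-\sqrt{\tilde q_i}}2$. Then: 1. The set $\{\alpha_1^{s_1}\cdots\alpha_r^{s_r}:(s_1,\dots,s_r)\in\{0,1\}^r\}$ is a $\mathbb Z$-basis of the ring of integers of the field $\mathbb Q(\sqrt{\tilde q_1},\dots,\sqrt{\tilde q_r})$. 2. The set $\{\tilde\alpha_1^{s_1}\alpha_1^{1-s_1}\cdots\tilde\alpha_r^{s_r}\alpha_r^{1-s_r}:(s_1,\dots,s_r)\in\{0,1\}^r\}$ is a $\mathbb Z$-basis of the ring of integers of the field $\mathbb Q(\sqrt{\tilde q_1},\dots,\sqrt{\tilde q_r})$.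
   Context: For each $i$, $\sqrt{\tilde q_i}\in\mathbb C$ denotes a fixed square root of $\tilde q_i$. The sets are understood as families indexed by $\{0,1\}^r$. *)

theory Defs
  imports
    Complex_Main
    "HOL-Library.FuncSet"
    "HOL-Computational_Algebra.Computational_Algebra"
    "HOL-Number_Theory.Cong"
    "HOL-Algebra.Generated_Fields"
    "HOL-Algebra.Algebraic_Closure_Type"
begin

text \<open>The subfield of the complex numbers generated by \<open>S\<close>. Every subfield contains the rationals,
  so this is the field usually written \<open>\<rat>(S)\<close>.\<close>

definition rat_adjoin :: "complex set \<Rightarrow> complex set" where
  "rat_adjoin S = generate_field ring_of_type_algebra S"

lemma subfield_rat_adjoin: "subfield (rat_adjoin S) ring_of_type_algebra"
  unfolding rat_adjoin_def
  by (rule field.generate_field_is_subfield[OF field_from_type_algebra])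
     (simp add: ring_of_type_algebra_def)

definition ring_of_integers :: "complex set \<Rightarrow> complex set" where
  "ring_of_integers K = {x \<in> K. algebraic_int x}"

definition int_scale :: "int \<Rightarrow> complex \<Rightarrow> complex" where
  "int_scale n x = of_int n * x"

lemma module_int_scale: "Modules.module int_scale"
  by unfold_locales (simp_all add: int_scale_def algebra_simps)

text \<open>Independence in the library is a property of sets, so injectivity is required in order to
  speak about the family \<open>b\<close> indexed by \<open>I\<close>.\<close>

definition is_int_basis :: "'i set \<Rightarrow> ('i \<Rightarrow> complex) \<Rightarrow> complex set \<Rightarrow> bool" where
  "is_int_basis I b M \<longleftrightarrow>
     inj_on b I \<and>
     \<not> Modules.module.dependent int_scale (b ` I) \<and>
     Modules.module.span int_scale (b ` I) = M"

end

theory Submission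
  imports Defs "Jordan_Normal_Form.Char_Poly"
begin

text \<open>Adjoin the square roots one at a time. Let \<open>K\<close> be the field obtained so far, let \<open>w\<^sup>2 = q\<close> be the
  next square and \<open>\<alpha> = (1 + w) / 2\<close>. It suffices that \<open>1, \<alpha>\<close> is a basis of the integers of \<open>K(w)\<close> over
  the integers of \<open>K\<close>: a \<open>\<int>\<close>-basis of the latter then yields one of the former by multiplying its
  members by \<open>1\<close> and by \<open>\<alpha>\<close>. Since \<open>\<alpha> + \<alpha>' = 1\<close> for the conjugate \<open>\<alpha>'\<close> of \<open>\<alpha>\<close>, the pair \<open>\<alpha>, \<alpha>'\<close> serves as
  well as \<open>1, \<alpha>\<close>, and this choice gives the second family.

  Take an integral \<open>x = a + b \<alpha>\<close> with \<open>a, b \<in> K\<close>. Its conjugate \<open>a + b \<alpha>'\<close> is integral too, hence so is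
  the difference \<open>b w\<close>. To pass from \<open>b w\<close> to \<open>b\<close> one needs that \<open>q\<close> is unramified in \<open>K\<close>. What is used
  of this is the property \<open>sqrt_absorbing K d\<close>: an element of \<open>K\<close> is integral as soon as its product
  with \<open>\<surd>d\<close> is. Over \<open>\<rat>\<close> it says that \<open>d\<close> is squarefree. It passes from \<open>K\<close> to \<open>K(w)\<close> by the same
  computation: if \<open>\<surd>d x\<close> is integral, then so is \<open>\<surd>d b w\<close>, that is, \<open>b\<close> times a square root of \<open>d q\<close>;
  and \<open>d q\<close> is again squarefree and coprime to the earlier \<open>q\<^sub>i\<close>. Quantifying over all such \<open>d\<close>
  therefore makes the induction close (lemma \<open>sqrt_absorbing_multiquadratic\<close>).

  The same property shows that the degree doubles at each step: if \<open>w \<in> K\<close>, then \<open>w * (1 / w)\<close> is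
  integral, so \<open>1 / w\<close> is integral and \<open>q\<close> is a unit. Conjugation is then well defined on \<open>K(w)\<close>.

  That sums and products of algebraic integers are algebraic integers is derived from the
  characteristic polynomial of an integer matrix.\<close>

interpretation int_module: Modules.module int_scale
  by (rule module_int_scale)

section \<open>Algebraic integers form a ring\<close>

text \<open>Multiplication by \<open>z\<close> acts on the generators \<open>V\<close> through an integer matrix that has the vector of
  generators as an eigenvector for \<open>z\<close>, so \<open>z\<close> is a root of its characteristic polynomial, which is
  monic with integer coefficients. The generator \<open>v \<noteq> 0\<close> makes this vector nonzero.\<close>

lemma algebraic_int_if_stable_span:
  assumes "finite V" "v \<in> V" "v \<noteq> 0"
    and stable: "\<And>v. v \<in> V \<Longrightarrow> z * v \<in> int_module.span V"
  shows "algebraic_int z"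
proof -
  obtain n f where V: "V = f ` {i::nat. i < n}" and inj: "inj_on f {i. i < n}"
    using finite_imp_nat_seg_image_inj_on[OF \<open>finite V\<close>] by metis
  have "\<forall>v\<in>V. \<exists>u. z * v = (\<Sum>t\<in>V. int_scale (u t) t)"
    using stable unfolding int_module.span_finite[OF \<open>finite V\<close>] by auto
  then obtain c where c: "\<And>v. v \<in> V \<Longrightarrow> z * v = (\<Sum>t\<in>V. int_scale (c v t) t)"
    by metis
  define A where "A = mat n n (\<lambda>(i, j). c (f i) (f j))"
  have A: "A \<in> carrier_mat n n"
    by (simp add: A_def)
  let ?A = "map_mat complex_of_int A"
  have row: "(\<Sum>j = 0..<n. of_int (c (f i) (f j)) * f j) = z * f i" if "i < n" for i
  proof -
    have "z * f i = (\<Sum>t\<in>V. int_scale (c (f i) t) t)"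
      using c that V by auto
    also have "\<dots> = (\<Sum>j | j < n. int_scale (c (f i) (f j)) (f j))"
      unfolding V by (subst sum.reindex[OF inj]) simp
    also have "{j. j < n} = {0..<n}"
      by auto
    finally show ?thesis
      by (simp add: int_scale_def)
  qed
  have "?A *\<^sub>v vec n f = z \<cdot>\<^sub>v vec n f"
    by (rule eq_vecI) (use A in \<open>auto simp: A_def scalar_prod_def row\<close>)
  moreover have "vec n f \<noteq> 0\<^sub>v n"
    using \<open>v \<in> V\<close> \<open>v \<noteq> 0\<close> unfolding V by (metis (mono_tags, lifting) imageE index_vec index_zero_vec(1) mem_Collect_eq)
  ultimately have "eigenvalue ?A z"
    unfolding eigenvalue_def eigenvector_def using A by (intro exI[of _ "vec n f"]) auto
  then have "poly (char_poly ?A) z = 0"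
    using A by (subst (asm) eigenvalue_root_char_poly[of _ n]) auto
  then have "poly (map_poly of_int (char_poly A)) z = 0"
    by (simp add: of_int_hom.char_poly_hom[OF A])
  moreover have "lead_coeff (char_poly A) = 1"
    using degree_monic_char_poly[OF A] by simp
  ultimately show ?thesis
    unfolding algebraic_int_altdef_ipoly by blast
qed

lemma mult_mem_span:
  assumes "s \<in> int_module.span V" and "\<And>v. v \<in> V \<Longrightarrow> z * v \<in> int_module.span W"
  shows "z * s \<in> int_module.span W"
  using assms(1)
proof (induction rule: int_module.span_induct_alt)
  case base
  then show ?case
    by (simp add: int_module.span_zero)
next
  case (step n v s)
  have "z * (int_scale n v + s) = int_scale n (z * v) + z * s"
    by (simp add: int_scale_def algebra_simps)
  then show ?case
    using step assms(2) by (simp add: int_module.span_add int_module.span_scale)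
qed

text \<open>A monic equation for \<open>x\<close> rewrites the leading power by lower ones. The exponent is positive because
  the monic constant \<open>1\<close> has no root.\<close>

lemma algebraic_int_power_in_span:
  assumes "algebraic_int x"
  obtains n where "n > 0" "x ^ n \<in> int_module.span ((\<lambda>i. x ^ i) ` {..<n})"
proof -
  obtain p where p: "poly (map_poly of_int p) x = 0" "lead_coeff p = 1"
    using assms unfolding algebraic_int_altdef_ipoly by blast
  define n where "n = degree p"
  have sum: "(\<Sum>i\<le>n. of_int (coeff p i) * x ^ i) = 0"
    using p(1) by (simp add: poly_altdef n_def coeff_map_poly degree_map_poly)
  have pow: "x ^ n = - (\<Sum>i<n. of_int (coeff p i) * x ^ i)"
  proof -
    have "{..n} = insert n {..<n}"
      by auto
    then show ?thesis
      using sum p(2) by (simp add: n_def eq_neg_iff_add_eq_0)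
  qed
  have "n > 0"
    using pow by (cases n) auto
  moreover have "x ^ n \<in> int_module.span ((\<lambda>i. x ^ i) ` {..<n})"
    unfolding pow int_scale_def[symmetric]
    by (intro int_module.span_neg int_module.span_sum int_module.span_scale int_module.span_base) auto
  ultimately show ?thesis
    using that by blast
qed

text \<open>The products \<open>x ^ i * y ^ j\<close> with \<open>i\<close> and \<open>j\<close> below the degrees of \<open>x\<close> and \<open>y\<close> span a module that is
  stable under both \<open>x\<close> and \<open>y\<close>, hence under their sum and product.\<close>

lemma
  fixes x y :: complex
  assumes "algebraic_int x" "algebraic_int y"
  shows algebraic_int_add: "algebraic_int (x + y)"
    and algebraic_int_mult: "algebraic_int (x * y)"
proof -
  obtain n where n: "n > 0" "x ^ n \<in> int_module.span ((\<lambda>i. x ^ i) ` {..<n})"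
    using algebraic_int_power_in_span[OF assms(1)] .
  obtain m where m: "m > 0" "y ^ m \<in> int_module.span ((\<lambda>i. y ^ i) ` {..<m})"
    using algebraic_int_power_in_span[OF assms(2)] .
  define V where "V = (\<lambda>(i, j). x ^ i * y ^ j) ` ({..<n} \<times> {..<m})"
  have V: "x ^ i * y ^ j \<in> V" if "i < n" "j < m" for i j
    using that unfolding V_def by (auto intro!: image_eqI[of _ _ "(i, j)"])
  have fin: "finite V"
    by (simp add: V_def)
  have one: "1 \<in> V"
    using V[of 0 0] n m by simp
  have x: "x * v \<in> int_module.span V" if "v \<in> V" for v
  proof -
    obtain i j where ij: "i < n" "j < m" "v = x ^ i * y ^ j"
      using \<open>v \<in> V\<close> by (auto simp: V_def)
    have "y ^ j * x ^ Suc i \<in> int_module.span V"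
    proof (cases "Suc i = n")
      case True
      show ?thesis
        unfolding True using n(2)
        by (rule mult_mem_span) (use ij V in \<open>auto simp: mult.commute intro: int_module.span_base\<close>)
    next
      case False
      then show ?thesis
        using V[of "Suc i" j] ij by (simp add: mult.commute int_module.span_base del: power_Suc)
    qed
    then show ?thesis
      by (simp add: ij mult_ac)
  qed
  have y: "y * v \<in> int_module.span V" if "v \<in> V" for v
  proof -
    obtain i j where ij: "i < n" "j < m" "v = x ^ i * y ^ j"
      using \<open>v \<in> V\<close> by (auto simp: V_def)
    have "x ^ i * y ^ Suc j \<in> int_module.span V"
    proof (cases "Suc j = m")
      case True
      show ?thesis
        unfolding True using m(2)
        by (rule mult_mem_span) (use ij V in \<open>auto intro: int_module.span_base\<close>)
    next
      case False
      then show ?thesis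
        using V[of i "Suc j"] ij by (simp add: int_module.span_base del: power_Suc)
    qed
    then show ?thesis
      by (simp add: ij mult_ac)
  qed
  show "algebraic_int (x + y)"
    by (rule algebraic_int_if_stable_span[OF fin one])
       (simp_all add: distrib_right int_module.span_add x y)
  show "algebraic_int (x * y)"
  proof (rule algebraic_int_if_stable_span[OF fin one])
    fix v assume "v \<in> V"
    then have "x * (y * v) \<in> int_module.span V"
      by (intro mult_mem_span[OF y] x)
    then show "x * y * v \<in> int_module.span V"
      by (simp add: mult.assoc)
  qed simp
qed

lemma algebraic_int_diff:
  fixes x y :: complex
  assumes "algebraic_int x" "algebraic_int y"
  shows "algebraic_int (x - y)"
  using algebraic_int_add[OF assms(1), of "- y"] assms(2) by simp

lemma algebraic_int_power2_iff:
  fixes x :: complex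
  shows "algebraic_int (x\<^sup>2) \<longleftrightarrow> algebraic_int x"
proof
  assume "algebraic_int (x\<^sup>2)"
  then show "algebraic_int x"
    by (rule algebraic_int_root[where p = "monom 1 2"]) (auto simp: poly_monom degree_monom_eq)
qed (simp add: power2_eq_square algebraic_int_mult)

text \<open>If \<open>q = 1 + 4 k\<close>, the element is a root of \<open>X\<^sup>2 - X - k\<close>.\<close>

lemma algebraic_int_quadratic_generator:
  fixes w :: complex
  assumes "w\<^sup>2 = of_int q" "[q = 1] (mod 4)"
  shows "algebraic_int ((1 + w) / 2)"
proof -
  obtain k where "q = 1 + 4 * k"
    using assms(2) by (metis cong_iff_lin cong_sym)
  then have k: "w * w = 1 + 4 * of_int k"
    using assms(1) by (simp add: power2_eq_square)
  show ?thesis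
    unfolding algebraic_int_altdef_ipoly
    by (rule exI[of _ "[:- k, - 1, 1:]"]) (use k in \<open>simp add: field_simps\<close>)
qed

section \<open>Adjoining a square root to a number field\<close>

lemma type_algebra_uminus: "\<ominus>\<^bsub>ring_of_type_algebra\<^esub> x = - (x :: complex)"
proof -
  interpret R: field "ring_of_type_algebra :: complex ring"
    by (rule field_from_type_algebra)
  show ?thesis
    by (rule R.minus_equality) (simp_all add: ring_of_type_algebra_def)
qed

lemma type_algebra_inverse:
  assumes "x \<noteq> (0 :: complex)"
  shows "inv\<^bsub>ring_of_type_algebra\<^esub> x = inverse x"
proof -
  interpret R: field "ring_of_type_algebra :: complex ring"
    by (rule field_from_type_algebra)
  show ?thesis
    by (rule R.comm_inv_char) (use assms in \<open>simp_all add: ring_of_type_algebra_def\<close>)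
qed

lemma rat_adjoin_incl: "x \<in> S \<Longrightarrow> x \<in> rat_adjoin S"
  by (simp add: rat_adjoin_def generate_field.incl)

lemma rat_adjoin_one: "1 \<in> rat_adjoin S"
  using generate_field.one[of ring_of_type_algebra S]
  by (simp add: rat_adjoin_def ring_of_type_algebra_def)

lemma rat_adjoin_uminus: "x \<in> rat_adjoin S \<Longrightarrow> - x \<in> rat_adjoin S"
  using generate_field.a_inv[of x ring_of_type_algebra S]
  by (simp add: rat_adjoin_def type_algebra_uminus)

lemma rat_adjoin_add: "x \<in> rat_adjoin S \<Longrightarrow> y \<in> rat_adjoin S \<Longrightarrow> x + y \<in> rat_adjoin S"
  using generate_field.eng_add[of x ring_of_type_algebra S y]
  by (simp add: rat_adjoin_def ring_of_type_algebra_def)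

lemma rat_adjoin_mult: "x \<in> rat_adjoin S \<Longrightarrow> y \<in> rat_adjoin S \<Longrightarrow> x * y \<in> rat_adjoin S"
  using generate_field.eng_mult[of x ring_of_type_algebra S y]
  by (simp add: rat_adjoin_def ring_of_type_algebra_def)

lemma rat_adjoin_diff: "x \<in> rat_adjoin S \<Longrightarrow> y \<in> rat_adjoin S \<Longrightarrow> x - y \<in> rat_adjoin S"
  using rat_adjoin_add[of x S "- y"] rat_adjoin_uminus by simp

lemma rat_adjoin_zero: "0 \<in> rat_adjoin S"
  using rat_adjoin_diff[OF rat_adjoin_one rat_adjoin_one] by simp

lemma rat_adjoin_inverse:
  assumes "x \<in> rat_adjoin S"
  shows "inverse x \<in> rat_adjoin S"
proof (cases "x = 0")
  case False
  then show ?thesis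
    using generate_field.m_inv[of x ring_of_type_algebra S] assms
    by (simp add: rat_adjoin_def type_algebra_inverse) (simp add: ring_of_type_algebra_def)
qed (simp add: rat_adjoin_zero)

lemma rat_adjoin_divide: "x \<in> rat_adjoin S \<Longrightarrow> y \<in> rat_adjoin S \<Longrightarrow> x / y \<in> rat_adjoin S"
  by (simp add: divide_inverse rat_adjoin_mult rat_adjoin_inverse)

lemma rat_adjoin_of_nat: "of_nat n \<in> rat_adjoin S"
  by (induction n) (simp_all add: rat_adjoin_zero rat_adjoin_one rat_adjoin_add)

lemma rat_adjoin_of_int: "of_int n \<in> rat_adjoin S"
  by (cases n) (simp_all add: rat_adjoin_of_nat rat_adjoin_uminus rat_adjoin_diff rat_adjoin_one)

lemma rat_adjoin_numeral: "numeral n \<in> rat_adjoin S"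
  using rat_adjoin_of_nat[of "numeral n"] by simp

lemmas rat_adjoin_closed =
  rat_adjoin_zero rat_adjoin_one rat_adjoin_uminus rat_adjoin_add rat_adjoin_diff rat_adjoin_mult
  rat_adjoin_inverse rat_adjoin_divide rat_adjoin_of_int rat_adjoin_numeral

lemma rat_adjoin_subset:
  assumes "S \<subseteq> T" "1 \<in> T"
    and "\<And>x. x \<in> T \<Longrightarrow> - x \<in> T" "\<And>x. x \<in> T \<Longrightarrow> inverse x \<in> T"
    and "\<And>x y. x \<in> T \<Longrightarrow> y \<in> T \<Longrightarrow> x + y \<in> T"
    and "\<And>x y. x \<in> T \<Longrightarrow> y \<in> T \<Longrightarrow> x * y \<in> T"
  shows "rat_adjoin S \<subseteq> T"
proof
  fix x assume "x \<in> rat_adjoin S"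
  then show "x \<in> T"
    unfolding rat_adjoin_def
  proof (induction rule: generate_field.induct)
    case one
    show ?case
      using assms(2) by (simp add: ring_of_type_algebra_def)
  next
    case (incl h)
    then show ?case
      using assms(1) by blast
  next
    case (a_inv h)
    then show ?case
      using assms(3) by (simp add: type_algebra_uminus)
  next
    case (m_inv h)
    then have "h \<noteq> 0"
      by (simp add: ring_of_type_algebra_def)
    then show ?case
      using m_inv assms(4) by (simp add: type_algebra_inverse)
  next
    case (eng_add x y)
    then show ?case
      using assms(5) by (simp add: ring_of_type_algebra_def)
  next
    case (eng_mult x y)
    then show ?case
      using assms(6) by (simp add: ring_of_type_algebra_def)
  qed
qed

lemma rat_adjoin_empty_subset: "rat_adjoin {} \<subseteq> \<rat>"
  by (rule rat_adjoin_subset) auto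

lemma rat_adjoin_mono: "S \<subseteq> T \<Longrightarrow> rat_adjoin S \<subseteq> rat_adjoin T"
  by (rule rat_adjoin_subset) (use rat_adjoin_incl in \<open>auto simp: rat_adjoin_closed\<close>)

text \<open>The elements \<open>a + b * w\<close> are closed under inverses because \<open>(a + b * w) * (a - b * w)\<close> lies in the
  smaller field.\<close>

lemma rat_adjoin_insert_sqrtE:
  assumes w: "w\<^sup>2 \<in> rat_adjoin S" and "x \<in> rat_adjoin (insert w S)"
  obtains a b where "a \<in> rat_adjoin S" "b \<in> rat_adjoin S" "x = a + b * w"
proof -
  let ?K = "rat_adjoin S"
  define T where "T = {a + b * w | a b. a \<in> ?K \<and> b \<in> ?K}"
  have TI: "x \<in> T" if "x = a + b * w" "a \<in> ?K" "b \<in> ?K" for x a b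
    using that T_def by blast
  have "rat_adjoin (insert w S) \<subseteq> T"
  proof (rule rat_adjoin_subset)
    have "w \<in> T"
      by (rule TI[of _ 0 1]) (simp_all add: rat_adjoin_closed)
    moreover have "s \<in> T" if "s \<in> S" for s
      by (rule TI[of _ s 0]) (use that in \<open>simp_all add: rat_adjoin_closed rat_adjoin_incl\<close>)
    ultimately show "insert w S \<subseteq> T"
      by auto
    show "1 \<in> T"
      by (rule TI[of _ 1 0]) (simp_all add: rat_adjoin_closed)
  next
    fix x assume "x \<in> T"
    then obtain a b where x: "a \<in> ?K" "b \<in> ?K" "x = a + b * w"
      unfolding T_def by blast
    show "- x \<in> T"
      by (rule TI[of _ "- a" "- b"]) (use x in \<open>simp_all add: rat_adjoin_closed\<close>)
    show "inverse x \<in> T"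
    proof (cases "w \<in> ?K")
      case True
      then show ?thesis
        by (intro TI[of _ "inverse x" 0]) (use x in \<open>simp_all add: rat_adjoin_closed\<close>)
    next
      case False
      have "inverse x = a / (a\<^sup>2 - b\<^sup>2 * w\<^sup>2) + (- b / (a\<^sup>2 - b\<^sup>2 * w\<^sup>2)) * w"
      proof (cases "a - b * w = 0")
        case True
        \<comment> \<open>Then \<open>x = 0\<close>, and the formula reads \<open>0 = 0\<close>, since division by zero yields zero.\<close>
        have "b = 0"
        proof (rule ccontr)
          assume "b \<noteq> 0"
          then have "w = a / b"
            using True by (simp add: field_simps)
          then show False
            using False x rat_adjoin_divide by blast
        qed
        then show ?thesis
          using True x by simp
      next
        case False
        have "a\<^sup>2 - b\<^sup>2 * w\<^sup>2 = x * (a - b * w)"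
          by (simp add: x power2_eq_square algebra_simps)
        then have "a / (a\<^sup>2 - b\<^sup>2 * w\<^sup>2) + (- b / (a\<^sup>2 - b\<^sup>2 * w\<^sup>2)) * w
            = (a - b * w) / (x * (a - b * w))"
          by (simp add: diff_divide_distrib)
        also have "\<dots> = inverse x"
          using False by (simp add: inverse_eq_divide)
        finally show ?thesis ..
      qed
      then show ?thesis
        by (rule TI) (use x w in \<open>simp_all add: rat_adjoin_closed power2_eq_square\<close>)
    qed
    fix y assume "y \<in> T"
    then obtain c d where y: "c \<in> ?K" "d \<in> ?K" "y = c + d * w"
      unfolding T_def by blast
    show "x + y \<in> T"
      by (rule TI[of _ "a + c" "b + d"])
         (use x y in \<open>simp_all add: rat_adjoin_closed algebra_simps\<close>)
    show "x * y \<in> T"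
      by (rule TI[of _ "a * c + b * d * w\<^sup>2" "a * d + b * c"])
         (use x y w in \<open>simp_all add: rat_adjoin_closed algebra_simps power2_eq_square\<close>)
  qed
  then show ?thesis
    using that assms(2) unfolding T_def by blast
qed

text \<open>Evaluating an integer polynomial commutes with \<open>w \<mapsto> - w\<close>, and \<open>A + B * w\<close> vanishes only for
  \<open>A = B = 0\<close>; so \<open>a + b * w\<close> and \<open>a - b * w\<close> are roots of the same integer polynomials.\<close>

lemma algebraic_int_conjugate:
  assumes w: "w \<notin> rat_adjoin S" "w\<^sup>2 \<in> rat_adjoin S"
    and ab: "a \<in> rat_adjoin S" "b \<in> rat_adjoin S"
    and int: "algebraic_int (a + b * w)"
  shows "algebraic_int (a - b * w)"
proof -
  let ?K = "rat_adjoin S"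
  have "\<exists>A\<in>?K. \<exists>B\<in>?K. poly (map_poly of_int p) (a + b * w) = A + B * w \<and>
          poly (map_poly of_int p) (a - b * w) = A - B * w" for p :: "int poly"
  proof (induction p)
    case 0
    show ?case
      by (intro bexI[of _ 0]) (simp_all add: rat_adjoin_closed)
  next
    case (pCons c p)
    then obtain A B where *: "A \<in> ?K" "B \<in> ?K"
      "poly (map_poly of_int p) (a + b * w) = A + B * w"
      "poly (map_poly of_int p) (a - b * w) = A - B * w"
      by blast
    have eval: "poly (map_poly of_int (pCons c p)) z = of_int c + z * poly (map_poly of_int p) z"
      for z :: complex
      by (simp add: of_int_hom.map_poly_pCons_hom)
    show ?case
      by (rule bexI[of _ "of_int c + a * A + b * B * w\<^sup>2"], rule bexI[of _ "a * B + b * A"])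
         (use *(1,2) w ab in \<open>simp_all add: eval *(3,4) rat_adjoin_closed power2_eq_square algebra_simps\<close>)
  qed
  moreover obtain p where p: "poly (map_poly of_int p) (a + b * w) = 0" "lead_coeff p = 1"
    using int unfolding algebraic_int_altdef_ipoly by blast
  ultimately obtain A B where AB: "A \<in> ?K" "B \<in> ?K" "A + B * w = 0"
    "poly (map_poly of_int p) (a - b * w) = A - B * w"
    by metis
  have "B = 0"
  proof (rule ccontr)
    assume "B \<noteq> 0"
    then have "w = - A / B"
      using AB(3) by (simp add: field_simps eq_neg_iff_add_eq_0)
    then show False
      using w AB by (metis rat_adjoin_divide rat_adjoin_uminus)
  qed
  then have "poly (map_poly of_int p) (a - b * w) = 0"
    using AB by simp
  then show ?thesis
    using p(2) unfolding algebraic_int_altdef_ipoly by blast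
qed

section \<open>Fields that absorb the square root of an integer\<close>

text \<open>For squarefree \<open>d\<close> a number field has this property when it is unramified at the primes dividing
  \<open>d\<close>. Since \<open>y\<close> is integral if and only if \<open>y\<^sup>2\<close> is, the condition on \<open>d * x\<^sup>2\<close> says that \<open>\<surd>d * x\<close> is
  integral without choosing a root of \<open>d\<close>.\<close>

definition sqrt_absorbing :: "complex set \<Rightarrow> int \<Rightarrow> bool" where
  "sqrt_absorbing K d \<longleftrightarrow> (\<forall>x\<in>K. algebraic_int (of_int d * x\<^sup>2) \<longrightarrow> algebraic_int x)"

lemma sqrt_absorbing_one: "sqrt_absorbing K 1"
  by (simp add: sqrt_absorbing_def algebraic_int_power2_iff)

text \<open>If \<open>d * (m / n)\<^sup>2\<close> is an integer with \<open>m / n\<close> in lowest terms, then \<open>n\<^sup>2\<close> divides \<open>d\<close>.\<close>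

lemma sqrt_absorbing_Rats:
  assumes "squarefree d"
  shows "sqrt_absorbing \<rat> d"
  unfolding sqrt_absorbing_def
proof (intro ballI impI)
  fix x :: complex
  assume x: "x \<in> \<rat>" "algebraic_int (of_int d * x\<^sup>2)"
  then obtain m n where mn: "n > 0" "coprime m n" "x = of_int m / of_int n"
    by (elim Rats_cases') blast
  have "of_int d * x\<^sup>2 \<in> \<int>"
    by (rule rational_algebraic_int_is_int) (use x in auto)
  then obtain k where "of_int d * x\<^sup>2 = of_int k"
    by (auto elim: Ints_cases)
  then have "of_int (d * m\<^sup>2) = (of_int (k * n\<^sup>2) :: complex)"
    using mn by (simp add: field_simps power2_eq_square)
  then have "d * m\<^sup>2 = k * n\<^sup>2"
    using of_int_eq_iff by blast
  then have "n\<^sup>2 dvd d * m\<^sup>2"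
    by simp
  then have "n\<^sup>2 dvd d"
    using mn(2) by (simp add: coprime_commute coprime_dvd_mult_left_iff)
  then have "n = 1"
    using squarefreeD[OF assms, of n] mn(1) by simp
  then show "algebraic_int x"
    using mn by simp
qed

text \<open>Otherwise the property applies to \<open>inverse w\<close>, because \<open>q * (inverse w)\<^sup>2 = 1\<close> is integral; then
  \<open>inverse q = (inverse w)\<^sup>2\<close> is a rational algebraic integer, and \<open>q\<close> is a unit.\<close>

lemma sqrt_notin_if_absorbing:
  assumes "sqrt_absorbing (rat_adjoin S) q" "w\<^sup>2 = of_int q" "q \<noteq> 0" "\<not> is_unit q"
  shows "w \<notin> rat_adjoin S"
proof
  assume "w \<in> rat_adjoin S"
  moreover have "algebraic_int (of_int q * (inverse w)\<^sup>2)"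
    using assms(2,3) by (simp add: power_inverse)
  ultimately have "algebraic_int (inverse w)"
    using assms(1) rat_adjoin_inverse unfolding sqrt_absorbing_def by blast
  then have "algebraic_int (inverse (of_int q :: complex))"
    using assms(2) algebraic_int_power2_iff[of "inverse w"] by (simp add: power_inverse)
  then have "inverse (of_int q :: complex) \<in> \<int>"
    by (rule rational_algebraic_int_is_int) auto
  then obtain k where "inverse (of_int q :: complex) = of_int k"
    by (auto elim: Ints_cases)
  then have "of_int (q * k) = (1 :: complex)"
    using assms(3) by (simp add: field_simps)
  then have "q * k = 1"
    using of_int_eq_1_iff by blast
  then show False
    using assms(4) by (metis dvd_triv_left)
qed

text \<open>The heart of the argument. With \<open>t\<^sup>2 = d\<close>, subtracting the conjugate from \<open>t * (a + b * \<alpha>)\<close> leaves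
  \<open>t * b * w\<close>, whose square is \<open>d * q * b\<^sup>2\<close>; this is where the property for \<open>d * q\<close> is needed. Once
  \<open>b\<close> is known to be integral, so is \<open>t * a\<close>, and the property for \<open>d\<close> takes care of \<open>a\<close>. The case
  \<open>d = 1\<close> is about the integers of the extension; general \<open>d\<close> passes the property on to it.\<close>

lemma algebraic_int_coordinates:
  assumes q: "w\<^sup>2 = of_int q" "[q = 1] (mod 4)" "\<not> is_unit q"
    and absorbing: "sqrt_absorbing (rat_adjoin S) q" "sqrt_absorbing (rat_adjoin S) d"
      "sqrt_absorbing (rat_adjoin S) (d * q)"
    and ab: "a \<in> rat_adjoin S" "b \<in> rat_adjoin S"
    and int: "algebraic_int (of_int d * (a + b * ((1 + w) / 2))\<^sup>2)"
  shows "algebraic_int a" "algebraic_int b"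
proof -
  let ?\<alpha> = "(1 + w) / 2"
  let ?\<alpha>' = "(1 - w) / 2"
  have "q \<noteq> 0"
    using q(2) by (auto simp: cong_def)
  then have w: "w \<notin> rat_adjoin S"
    using sqrt_notin_if_absorbing absorbing(1) q(1,3) by blast
  have \<alpha>: "algebraic_int ?\<alpha>"
    using algebraic_int_quadratic_generator q by blast
  define a' where "a' = a + b / 2"
  define b' where "b' = b / 2"
  have x: "a + b * ?\<alpha> = a' + b' * w" and y: "a + b * ?\<alpha>' = a' - b' * w"
    by (simp_all add: a'_def b'_def add_divide_distrib diff_divide_distrib ring_distribs)
  \<comment> \<open>Conjugation is applied to \<open>d * x\<^sup>2\<close>, which lies in the extension, and not to \<open>t * x\<close>, which need not.\<close>
  define A where "A = of_int d * (a' * a' + b' * b' * of_int q)"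
  define B where "B = of_int d * (2 * a' * b')"
  have AB: "A \<in> rat_adjoin S" "B \<in> rat_adjoin S"
    unfolding A_def B_def a'_def b'_def by (intro rat_adjoin_closed ab)+
  have "of_int d * (a + b * ?\<alpha>)\<^sup>2 = A + B * w" and "of_int d * (a + b * ?\<alpha>')\<^sup>2 = A - B * w"
    unfolding x y A_def B_def q(1)[symmetric] by (simp_all add: algebra_simps power2_eq_square)
  then have int': "algebraic_int (of_int d * (a + b * ?\<alpha>')\<^sup>2)"
    using algebraic_int_conjugate[OF w _ AB] int q(1) rat_adjoin_of_int by simp
  define t where "t = csqrt (of_int d)"
  have t: "t\<^sup>2 = of_int d"
    by (simp add: t_def)
  have tx: "algebraic_int (t * (a + b * ?\<alpha>))"
    using int by (subst algebraic_int_power2_iff[symmetric]) (simp add: power_mult_distrib t)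
  have ty: "algebraic_int (t * (a + b * ?\<alpha>'))"
    using int' by (subst algebraic_int_power2_iff[symmetric]) (simp add: power_mult_distrib t)
  have "t * (a + b * ?\<alpha>) - t * (a + b * ?\<alpha>') = t * b * w"
    unfolding x y by (simp add: b'_def algebra_simps)
  then have "algebraic_int (t * b * w)"
    using algebraic_int_diff[OF tx ty] by simp
  then have "algebraic_int (of_int (d * q) * b\<^sup>2)"
    by (subst (asm) algebraic_int_power2_iff[symmetric]) (simp add: power_mult_distrib t q mult_ac)
  then show b: "algebraic_int b"
    using absorbing ab unfolding sqrt_absorbing_def by blast
  have "algebraic_int t"
    by (subst algebraic_int_power2_iff[symmetric]) (simp add: t)
  then have "algebraic_int (t * (a + b * ?\<alpha>) - t * (b * ?\<alpha>))"
    by (intro algebraic_int_diff[OF tx] algebraic_int_mult b \<alpha>)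
  then have "algebraic_int (t * a)"
    by (simp add: algebra_simps)
  then have "algebraic_int (of_int d * a\<^sup>2)"
    by (subst (asm) algebraic_int_power2_iff[symmetric]) (simp add: power_mult_distrib t)
  then show "algebraic_int a"
    using absorbing ab unfolding sqrt_absorbing_def by blast
qed

lemma rat_adjoin_insert_generatorE:
  assumes "w\<^sup>2 = of_int q" "x \<in> rat_adjoin (insert w S)"
  obtains a b where "a \<in> rat_adjoin S" "b \<in> rat_adjoin S" "x = a + b * ((1 + w) / 2)"
proof -
  obtain a b where "a \<in> rat_adjoin S" "b \<in> rat_adjoin S" "x = a + b * w"
    using rat_adjoin_insert_sqrtE assms rat_adjoin_of_int by metis
  then show ?thesis
    by (intro that[of "a - b" "2 * b"]) (simp_all add: rat_adjoin_closed field_simps)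
qed

lemma sqrt_absorbing_insert:
  assumes q: "w\<^sup>2 = of_int q" "[q = 1] (mod 4)" "\<not> is_unit q"
    and "sqrt_absorbing (rat_adjoin S) q" "sqrt_absorbing (rat_adjoin S) d"
      "sqrt_absorbing (rat_adjoin S) (d * q)"
  shows "sqrt_absorbing (rat_adjoin (insert w S)) d"
  unfolding sqrt_absorbing_def
proof (intro ballI impI)
  fix x
  assume "x \<in> rat_adjoin (insert w S)" and int: "algebraic_int (of_int d * x\<^sup>2)"
  then obtain a b where ab: "a \<in> rat_adjoin S" "b \<in> rat_adjoin S" "x = a + b * ((1 + w) / 2)"
    using rat_adjoin_insert_generatorE q(1) by metis
  then have "algebraic_int a" "algebraic_int b"
    using algebraic_int_coordinates assms int by metis+
  then show "algebraic_int x"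
    unfolding ab(3) using algebraic_int_quadratic_generator[OF q(1,2)]
    by (intro algebraic_int_add algebraic_int_mult)
qed

lemma
  assumes q: "w\<^sup>2 = of_int q" "[q = 1] (mod 4)" "\<not> is_unit q"
    and absorbing: "sqrt_absorbing (rat_adjoin S) q"
  shows ring_of_integers_insert_sqrt:
      "ring_of_integers (rat_adjoin (insert w S)) =
        {a + b * ((1 + w) / 2) | a b.
          a \<in> ring_of_integers (rat_adjoin S) \<and> b \<in> ring_of_integers (rat_adjoin S)}"
        (is "?O' = ?R")
    and generator_independent:
      "\<And>a b. a \<in> rat_adjoin S \<Longrightarrow> b \<in> rat_adjoin S \<Longrightarrow> a + b * ((1 + w) / 2) = 0 \<Longrightarrow>
        a = 0 \<and> b = 0"
proof -
  have "?O' \<subseteq> ?R"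
  proof
    fix x assume "x \<in> ?O'"
    then have x: "x \<in> rat_adjoin (insert w S)" "algebraic_int x"
      by (auto simp: ring_of_integers_def)
    then obtain a b where ab: "a \<in> rat_adjoin S" "b \<in> rat_adjoin S" "x = a + b * ((1 + w) / 2)"
      using rat_adjoin_insert_generatorE q(1) by metis
    have "algebraic_int (of_int 1 * x\<^sup>2)"
      using x by (simp add: algebraic_int_power2_iff)
    then have "algebraic_int a" "algebraic_int b"
      using algebraic_int_coordinates[OF q absorbing sqrt_absorbing_one _ ab(1,2)] absorbing ab(3)
      by simp_all
    then show "x \<in> ?R"
      using ab by (auto simp: ring_of_integers_def)
  qed
  moreover have "?R \<subseteq> ?O'"
  proof
    fix x assume "x \<in> ?R"
    then obtain a b where ab: "a \<in> rat_adjoin S" "algebraic_int a" "b \<in> rat_adjoin S" "algebraic_int b"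
      and x: "x = a + b * ((1 + w) / 2)"
      by (auto simp: ring_of_integers_def)
    have "algebraic_int x"
      unfolding x using ab algebraic_int_quadratic_generator[OF q(1,2)]
      by (intro algebraic_int_add algebraic_int_mult)
    moreover have "rat_adjoin S \<subseteq> rat_adjoin (insert w S)"
      by (rule rat_adjoin_mono) auto
    then have "x \<in> rat_adjoin (insert w S)"
      unfolding x using ab rat_adjoin_incl[of w "insert w S"] by (intro rat_adjoin_closed) auto
    ultimately show "x \<in> ?O'"
      by (simp add: ring_of_integers_def)
  qed
  ultimately show "?O' = ?R"
    by blast
next
  fix a b
  assume ab: "a \<in> rat_adjoin S" "b \<in> rat_adjoin S" "a + b * ((1 + w) / 2) = 0"
  have "b = 0"
  proof (rule ccontr)
    assume "b \<noteq> 0"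
    moreover have "b * w = - 2 * a - b"
    proof -
      have "b * w = 2 * (a + b * ((1 + w) / 2)) - 2 * a - b"
        by (simp add: ring_distribs)
      then show ?thesis
        unfolding ab(3) by simp
    qed
    ultimately have "w = (- 2 * a - b) / b"
      by (simp add: nonzero_eq_divide_eq mult.commute)
    also have "\<dots> \<in> rat_adjoin S"
      using ab by (intro rat_adjoin_closed)
    finally have "w \<in> rat_adjoin S" .
    moreover have "q \<noteq> 0"
      using q(2) by (auto simp: cong_def)
    ultimately show False
      using sqrt_notin_if_absorbing absorbing q(1,3) by blast
  qed
  then show "a = 0 \<and> b = 0"
    using ab by simp
qed

section \<open>Product bases\<close>

text \<open>For a finite family, independence stated with coefficients indexed by the family itself already
  forces injectivity: two equal members would satisfy the relation with coefficients \<open>1\<close> and \<open>-1\<close>.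
  In this form bases can be handled by sums over the index set.\<close>

lemma is_int_basis_finite_iff:
  assumes "finite I"
  shows "is_int_basis I b M \<longleftrightarrow>
    (\<forall>c. (\<Sum>i\<in>I. of_int (c i) * b i) = 0 \<longrightarrow> (\<forall>i\<in>I. c i = 0)) \<and>
    range (\<lambda>c. \<Sum>i\<in>I. of_int (c i) * b i) = M" (is "_ \<longleftrightarrow> ?indep \<and> ?span = M")
proof -
  have inj: "inj_on b I" if ?indep
  proof (rule inj_onI, rule ccontr)
    fix i j assume ij: "i \<in> I" "j \<in> I" "b i = b j" "i \<noteq> j"
    let ?c = "\<lambda>k. if k = i then 1 else if k = j then - 1 else (0 :: int)"
    have "(\<Sum>k\<in>I. of_int (?c k) * b k) = (\<Sum>k\<in>{i, j}. of_int (?c k) * b k)"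
      using ij assms by (intro sum.mono_neutral_right) auto
    then have "(\<Sum>k\<in>I. of_int (?c k) * b k) = 0"
      using ij by simp
    from mp[OF spec[OF that, of ?c] this] show False
      using ij(1) by auto
  qed
  have image: "(\<Sum>v\<in>b ` I. int_scale (u v) v) = (\<Sum>i\<in>I. of_int (u (b i)) * b i)"
    if "inj_on b I" for u
    using that by (simp add: sum.reindex int_scale_def)
  have pull: "(\<Sum>i\<in>I. of_int (c i) * b i) = (\<Sum>v\<in>b ` I. int_scale (c (the_inv_into I b v)) v)"
    if "inj_on b I" for c
    using that by (simp add: image the_inv_into_f_f)
  have dep: "\<not> int_module.dependent (b ` I) \<longleftrightarrow> ?indep" if "inj_on b I"
  proof
    assume "\<not> int_module.dependent (b ` I)"
    then have *: "\<And>u. (\<Sum>v\<in>b ` I. int_scale (u v) v) = 0 \<Longrightarrow> \<forall>v\<in>b ` I. u v = 0"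
      using assms by (subst (asm) int_module.dependent_finite) auto
    show ?indep
    proof (intro allI impI ballI)
      fix c i assume "(\<Sum>i\<in>I. of_int (c i) * b i) = 0" "i \<in> I"
      then have "c (the_inv_into I b (b i)) = 0"
        using *[of "\<lambda>v. c (the_inv_into I b v)"] pull[OF that, of c] by simp
      then show "c i = 0"
        using that \<open>i \<in> I\<close> by (simp add: the_inv_into_f_f)
    qed
  next
    assume indep: ?indep
    show "\<not> int_module.dependent (b ` I)"
    proof
      assume "int_module.dependent (b ` I)"
      then obtain u where "\<exists>v\<in>b ` I. u v \<noteq> 0" "(\<Sum>v\<in>b ` I. int_scale (u v) v) = 0"
        using assms by (subst (asm) int_module.dependent_finite) auto
      then show False
        using indep image[OF that, of u] by auto
    qed
  qed
  have span: "int_module.span (b ` I) = ?span" if "inj_on b I"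
    unfolding int_module.span_finite[OF finite_imageI[OF assms]]
  proof (intro equalityI subsetI)
    fix x assume "x \<in> range (\<lambda>u. \<Sum>v\<in>b ` I. int_scale (u v) v)"
    then obtain u where "x = (\<Sum>v\<in>b ` I. int_scale (u v) v)"
      by (rule rangeE)
    then show "x \<in> ?span"
      unfolding image[OF that] by (rule range_eqI[where x = "\<lambda>i. u (b i)"])
  next
    fix x assume "x \<in> ?span"
    then obtain c where "x = (\<Sum>i\<in>I. of_int (c i) * b i)"
      by (rule rangeE)
    then show "x \<in> range (\<lambda>u. \<Sum>v\<in>b ` I. int_scale (u v) v)"
      unfolding pull[OF that] by (rule range_eqI[where x = "\<lambda>v. c (the_inv_into I b v)"])
  qed
  show ?thesis
    unfolding is_int_basis_def using inj dep span by blast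
qed

lemma sum_PiE_insert_01:
  fixes g :: "('i \<Rightarrow> nat) \<Rightarrow> 'a :: comm_monoid_add"
  assumes "finite A" "k \<notin> A"
  shows "(\<Sum>s\<in>insert k A \<rightarrow>\<^sub>E {0, 1}. g s) = (\<Sum>s\<in>A \<rightarrow>\<^sub>E {0, 1}. g (s(k := 0)) + g (s(k := 1)))"
proof -
  have inj: "inj_on (\<lambda>(y, s). s(k := y)) ({0, 1 :: nat} \<times> (A \<rightarrow>\<^sub>E {0, 1 :: nat}))"
    using inj_combinator[OF assms(2), of "\<lambda>_. {0, 1 :: nat}"] by simp
  have "(\<Sum>s\<in>insert k A \<rightarrow>\<^sub>E {0, 1}. g s)
      = (\<Sum>(y, s)\<in>{0, 1} \<times> (A \<rightarrow>\<^sub>E {0, 1}). g (s(k := y)))"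
    unfolding PiE_insert_eq by (subst sum.reindex[OF inj]) (simp add: case_prod_unfold)
  also have "\<dots> = (\<Sum>y\<in>{0, 1}. \<Sum>s\<in>A \<rightarrow>\<^sub>E {0, 1}. g (s(k := y)))"
    by (simp add: sum.cartesian_product)
  also have "\<dots> = (\<Sum>s\<in>A \<rightarrow>\<^sub>E {0, 1}. g (s(k := 0)) + g (s(k := 1)))"
    by (simp add: sum.distrib)
  finally show ?thesis .
qed

text \<open>Elements of \<open>N\<close> have unique coordinates in \<open>M\<close> with respect to \<open>f k 0, f k 1\<close>, and these in turn have
  unique integer coordinates. The value of an index at \<open>k\<close> tells which of the two coordinates is
  expanded.\<close>

lemma is_int_basis_product_insert:
  fixes f :: "'i \<Rightarrow> nat \<Rightarrow> complex"
  assumes "finite A" "k \<notin> A"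
    and basis: "is_int_basis (A \<rightarrow>\<^sub>E {0, 1}) (\<lambda>s. \<Prod>i\<in>A. f i (s i)) M"
    and indep: "\<And>x y. x \<in> M \<Longrightarrow> y \<in> M \<Longrightarrow> x * f k 0 + y * f k 1 = 0 \<Longrightarrow> x = 0 \<and> y = 0"
    and N: "N = {x * f k 0 + y * f k 1 | x y. x \<in> M \<and> y \<in> M}"
  shows "is_int_basis (insert k A \<rightarrow>\<^sub>E {0, 1}) (\<lambda>s. \<Prod>i\<in>insert k A. f i (s i)) N"
proof -
  let ?P = "\<lambda>A :: 'i set. A \<rightarrow>\<^sub>E {0, 1 :: nat}"
  define b where "b = (\<lambda>s. \<Prod>i\<in>A. f i (s i))"
  define comb where "comb c = (\<Sum>s\<in>?P A. of_int (c s) * b s)" for c :: "_ \<Rightarrow> int"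
  have fin: "finite (?P B)" if "finite B" for B
    using that by (intro finite_PiE) auto
  have prod: "(\<Prod>i\<in>insert k A. f i ((s(k := n)) i)) = b s * f k n" for s n
  proof -
    have "(\<Prod>i\<in>A. f i ((s(k := n)) i)) = b s"
      unfolding b_def using assms(2) by (intro prod.cong) auto
    then show ?thesis
      using assms(1,2) by simp
  qed
  have split: "(\<Sum>s\<in>?P (insert k A). of_int (c s) * (\<Prod>i\<in>insert k A. f i (s i)))
      = comb (\<lambda>s. c (s(k := 0))) * f k 0 + comb (\<lambda>s. c (s(k := 1))) * f k 1" for c
    unfolding sum_PiE_insert_01[OF assms(1,2)] prod
    by (simp add: comb_def sum.distrib sum_distrib_right mult.assoc)
  have old: "\<And>c. comb c = 0 \<Longrightarrow> \<forall>s\<in>?P A. c s = 0" and M: "M = range comb"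
    using basis unfolding is_int_basis_finite_iff[OF fin[OF assms(1)]] comb_def b_def by auto
  have "c s = 0"
    if "(\<Sum>s\<in>?P (insert k A). of_int (c s) * (\<Prod>i\<in>insert k A. f i (s i))) = 0"
      "s \<in> ?P (insert k A)" for c s
  proof -
    have "comb (\<lambda>s. c (s(k := 0))) = 0 \<and> comb (\<lambda>s. c (s(k := 1))) = 0"
      using that(1) unfolding split by (intro indep) (auto simp: M)
    then have zero: "\<forall>s\<in>?P A. c (s(k := 0)) = 0" "\<forall>s\<in>?P A. c (s(k := 1)) = 0"
      using old[of "\<lambda>s. c (s(k := 0))"] old[of "\<lambda>s. c (s(k := 1))"] by blast+
    obtain y s' where "y \<in> {0, 1}" "s' \<in> ?P A" "s = s'(k := y)"
      using \<open>s \<in> ?P (insert k A)\<close> unfolding PiE_insert_eq by auto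
    then show "c s = 0"
      using zero by auto
  qed
  moreover have "range (\<lambda>c. \<Sum>s\<in>?P (insert k A). of_int (c s) * (\<Prod>i\<in>insert k A. f i (s i))) = N"
  proof -
    have "\<exists>c. x * f k 0 + y * f k 1 = comb (\<lambda>s. c (s(k := 0))) * f k 0 + comb (\<lambda>s. c (s(k := 1))) * f k 1"
      if "x \<in> M" "y \<in> M" for x y
    proof -
      obtain c d where cd: "x = comb c" "y = comb d"
        using \<open>x \<in> M\<close> \<open>y \<in> M\<close> M by auto
      \<comment> \<open>Resetting \<open>k\<close> to \<open>undefined\<close> turns an index over \<open>insert k A\<close> back into one over \<open>A\<close>.\<close>
      let ?e = "\<lambda>s. if s k = 0 then c (s(k := undefined)) else d (s(k := undefined))"
      have restore: "s(k := undefined) = s" if "s \<in> ?P A" for s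
        using that assms(2) by (auto simp: PiE_def extensional_def)
      have "comb (\<lambda>s. ?e (s(k := 0))) = comb c" "comb (\<lambda>s. ?e (s(k := 1))) = comb d"
        unfolding comb_def by (intro sum.cong refl; simp add: restore)+
      then show ?thesis
        unfolding cd by (intro exI[of _ ?e]) simp
    qed
    moreover have "comb c \<in> M" for c
      by (simp add: M)
    ultimately show ?thesis
      unfolding split N image_def by blast
  qed
  ultimately show ?thesis
    unfolding is_int_basis_finite_iff[OF fin[OF finite.insertI[OF assms(1)]]] by blast
qed

section \<open>Multiquadratic fields\<close>

text \<open>The condition \<open>\<not> is_unit (q i)\<close> excludes \<open>q i = 1\<close>, whose square roots are rational.\<close>

locale coprime_quadratic_family =
  fixes I :: "'i set" and q :: "'i \<Rightarrow> int" and w :: "'i \<Rightarrow> complex"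
  assumes squarefree: "i \<in> I \<Longrightarrow> squarefree (q i)"
    and nonunit: "i \<in> I \<Longrightarrow> \<not> is_unit (q i)"
    and mod4: "i \<in> I \<Longrightarrow> [q i = 1] (mod 4)"
    and coprime: "i \<in> I \<Longrightarrow> j \<in> I \<Longrightarrow> i \<noteq> j \<Longrightarrow> coprime (q i) (q j)"
    and sqrt: "i \<in> I \<Longrightarrow> (w i)\<^sup>2 = of_int (q i)"
begin

text \<open>The induction must quantify over \<open>d\<close>: the step for \<open>d\<close> uses the hypothesis for \<open>d\<close>, for \<open>q k\<close> and
  for \<open>d * q k\<close>.\<close>

lemma sqrt_absorbing_multiquadratic:
  assumes "finite A" "A \<subseteq> I" "squarefree d" "\<And>i. i \<in> A \<Longrightarrow> coprime d (q i)"
  shows "sqrt_absorbing (rat_adjoin (w ` A)) d"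
  using assms
proof (induction A arbitrary: d rule: finite_induct)
  case empty
  then show ?case
    using sqrt_absorbing_Rats[of d] rat_adjoin_empty_subset unfolding sqrt_absorbing_def by auto
next
  case (insert k A)
  then have k: "k \<in> I" and A: "A \<subseteq> I"
    by blast+
  have coprime_k: "coprime (q k) (q i)" if "i \<in> A" for i
    by (rule coprime) (use that k A insert.hyps(2) in auto)
  have coprime_d: "coprime d (q i)" if "i \<in> insert k A" for i
    using insert.prems(3) that .
  have "squarefree (d * q k)"
    by (rule squarefree_mult_coprime) (use coprime_d insert.prems(2) squarefree[OF k] in auto)
  then have "sqrt_absorbing (rat_adjoin (w ` A)) (d * q k)"
    by (rule insert.IH[OF A]) (simp add: coprime_d coprime_k)
  moreover have "sqrt_absorbing (rat_adjoin (w ` A)) d"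
    by (rule insert.IH[OF A insert.prems(2)]) (simp add: coprime_d)
  moreover have "sqrt_absorbing (rat_adjoin (w ` A)) (q k)"
    by (rule insert.IH[OF A squarefree[OF k] coprime_k])
  ultimately show ?case
    unfolding image_insert by (intro sqrt_absorbing_insert[OF sqrt[OF k] mod4[OF k] nonunit[OF k]])
qed

text \<open>At every index one of the two relative bases \<open>1, \<alpha>\<close> and \<open>\<alpha>, \<alpha>'\<close> may be chosen, independently of the
  choice at the other indices.\<close>

lemma is_int_basis_multiquadratic:
  fixes f :: "'i \<Rightarrow> nat \<Rightarrow> complex"
  assumes "finite A" "A \<subseteq> I"
    and f: "\<And>i. i \<in> A \<Longrightarrow>
      (f i 0, f i 1) \<in> {(1, (1 + w i) / 2), ((1 + w i) / 2, (1 - w i) / 2)}"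
  shows "is_int_basis (A \<rightarrow>\<^sub>E {0, 1}) (\<lambda>s. \<Prod>i\<in>A. f i (s i))
    (ring_of_integers (rat_adjoin (w ` A)))"
  using assms
proof (induction A rule: finite_induct)
  case empty
  have "ring_of_integers (rat_adjoin {}) = \<int>"
    using rational_algebraic_int_is_int rat_adjoin_empty_subset rat_adjoin_of_int[of _ "{}"]
    unfolding ring_of_integers_def by (auto elim!: Ints_cases)
  then show ?case
    by (subst is_int_basis_finite_iff) (auto simp: Ints_def)
next
  case (insert k A)
  let ?K = "rat_adjoin (w ` A)"
  let ?O = "ring_of_integers ?K"
  let ?\<alpha> = "(1 + w k) / 2"
  have k: "k \<in> I"
    using insert.prems(1) by blast
  have coprime_k: "coprime (q k) (q i)" if "i \<in> A" for i
    by (rule coprime) (use that k insert.prems(1) insert.hyps(2) in auto)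
  have absorbing: "sqrt_absorbing ?K (q k)"
    by (rule sqrt_absorbing_multiquadratic[OF insert.hyps(1) _ squarefree[OF k] coprime_k])
       (use insert.prems(1) in auto)
  note quadratic = sqrt[OF k] mod4[OF k] nonunit[OF k] absorbing
  have O: "ring_of_integers (rat_adjoin (w ` insert k A)) = {a + b * ?\<alpha> | a b. a \<in> ?O \<and> b \<in> ?O}"
    using ring_of_integers_insert_sqrt[OF quadratic] by simp
  have unique: "a = 0 \<and> b = 0" if "a \<in> ?K" "b \<in> ?K" "a + b * ?\<alpha> = 0" for a b
    using generator_independent[OF quadratic that] .
  have sub: "?O \<subseteq> ?K"
    by (auto simp: ring_of_integers_def)
  have closed: "x + y \<in> ?O" "x - y \<in> ?O" if "x \<in> ?O" "y \<in> ?O" for x y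
    using that by (auto simp: ring_of_integers_def algebraic_int_add algebraic_int_diff rat_adjoin_closed)
  consider "f k 0 = 1" "f k 1 = ?\<alpha>" | "f k 0 = ?\<alpha>" "f k 1 = (1 - w k) / 2"
    using insert.prems(2)[of k] by auto
  then have "(\<forall>x\<in>?O. \<forall>y\<in>?O. x * f k 0 + y * f k 1 = 0 \<longrightarrow> x = 0 \<and> y = 0) \<and>
    ring_of_integers (rat_adjoin (w ` insert k A)) = {x * f k 0 + y * f k 1 | x y. x \<in> ?O \<and> y \<in> ?O}"
  proof cases
    case 1
    have eq: "x * f k 0 + y * f k 1 = x + y * ?\<alpha>" for x y
      by (simp only: 1 mult_1_right)
    show ?thesis
      unfolding O eq using unique sub by blast
  next
    case 2
    \<comment> \<open>Substituting \<open>\<alpha>' = 1 - \<alpha>\<close> is a unimodular change of the coordinates.\<close>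
    have eq: "x * f k 0 + y * f k 1 = y + (x - y) * ?\<alpha>" for x y
      unfolding 2 by (simp add: field_simps)
    have eq': "a + b * ?\<alpha> = (a + b) * f k 0 + a * f k 1" for a b
      unfolding eq by simp
    have "\<forall>x\<in>?O. \<forall>y\<in>?O. x * f k 0 + y * f k 1 = 0 \<longrightarrow> x = 0 \<and> y = 0"
      unfolding eq using unique sub closed by (metis eq_iff_diff_eq_0 subsetD)
    moreover have "{a + b * ?\<alpha> | a b. a \<in> ?O \<and> b \<in> ?O} = {x * f k 0 + y * f k 1 | x y. x \<in> ?O \<and> y \<in> ?O}"
    proof (intro equalityI subsetI)
      fix z assume "z \<in> {a + b * ?\<alpha> | a b. a \<in> ?O \<and> b \<in> ?O}"
      then show "z \<in> {x * f k 0 + y * f k 1 | x y. x \<in> ?O \<and> y \<in> ?O}"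
        using eq' closed by blast
    next
      fix z assume "z \<in> {x * f k 0 + y * f k 1 | x y. x \<in> ?O \<and> y \<in> ?O}"
      then show "z \<in> {a + b * ?\<alpha> | a b. a \<in> ?O \<and> b \<in> ?O}"
        using eq closed by blast
    qed
    ultimately show ?thesis
      unfolding O by blast
  qed
  then show ?case
    using insert by (intro is_int_basis_product_insert[where M = ?O]) auto
qed

end

theorem theorem6:
  fixes r :: nat and q :: "nat \<Rightarrow> int" and w \<alpha> \<alpha>' :: "nat \<Rightarrow> complex"
  assumes distinct: "inj_on q {1..r}"
    and prime: "\<And>i. i \<in> {1..r} \<Longrightarrow> Factorial_Ring.prime \<bar>q i\<bar> \<and> odd \<bar>q i\<bar>"
    and mod4: "\<And>i. i \<in> {1..r} \<Longrightarrow> [q i = 1] (mod 4)"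
    and sqrt: "\<And>i. i \<in> {1..r} \<Longrightarrow> (w i)\<^sup>2 = of_int (q i)"
    and alpha: "\<And>i. i \<in> {1..r} \<Longrightarrow> \<alpha> i = (1 + w i) / 2"
    and alpha': "\<And>i. i \<in> {1..r} \<Longrightarrow> \<alpha>' i = (1 - w i) / 2"
  shows
    "is_int_basis ({1..r} \<rightarrow>\<^sub>E {0, 1})
       (\<lambda>s. \<Prod>i=1..r. \<alpha> i ^ s i)
       (ring_of_integers (rat_adjoin (w ` {1..r}))) \<and>
     is_int_basis ({1..r} \<rightarrow>\<^sub>E {0, 1})
       (\<lambda>s. \<Prod>i=1..r. \<alpha>' i ^ s i * \<alpha> i ^ (1 - s i))
       (ring_of_integers (rat_adjoin (w ` {1..r})))"
proof -
  interpret coprime_quadratic_family "{1..r}" q w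
  proof
    fix i assume i: "i \<in> {1..r}"
    show "squarefree (q i)"
      using prime[OF i] squarefree_prime[of "\<bar>q i\<bar>"] by (auto simp: abs_if split: if_splits)
    show "\<not> is_unit (q i)"
      using prime[OF i] not_prime_unit[of "\<bar>q i\<bar>"] by auto
    show "[q i = 1] (mod 4)" "(w i)\<^sup>2 = of_int (q i)"
      using mod4 sqrt i by auto
    fix j assume j: "j \<in> {1..r}" and "i \<noteq> j"
    have "q i \<noteq> q j"
      using distinct i j \<open>i \<noteq> j\<close> by (meson inj_onD)
    \<comment> \<open>The residue modulo 4 fixes the sign, so distinct integers give distinct primes.\<close>
    moreover have "q i \<noteq> - q j"
      using mod4[OF i] mod4[OF j] unfolding cong_def by presburger
    ultimately have "\<bar>q i\<bar> \<noteq> \<bar>q j\<bar>"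
      by linarith
    then have "coprime \<bar>q i\<bar> \<bar>q j\<bar>"
      using prime i j by (intro primes_coprime) auto
    then show "coprime (q i) (q j)"
      by simp
  qed
  show ?thesis
  proof
    show "is_int_basis ({1..r} \<rightarrow>\<^sub>E {0, 1}) (\<lambda>s. \<Prod>i=1..r. \<alpha> i ^ s i)
       (ring_of_integers (rat_adjoin (w ` {1..r})))"
      by (rule is_int_basis_multiquadratic[where f = "\<lambda>i n. \<alpha> i ^ n"]) (auto simp: alpha)
    show "is_int_basis ({1..r} \<rightarrow>\<^sub>E {0, 1}) (\<lambda>s. \<Prod>i=1..r. \<alpha>' i ^ s i * \<alpha> i ^ (1 - s i))
       (ring_of_integers (rat_adjoin (w ` {1..r})))"
      by (rule is_int_basis_multiquadratic[where f = "\<lambda>i n. \<alpha>' i ^ n * \<alpha> i ^ (1 - n)"])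
         (auto simp: alpha alpha')
  qed
qed

end
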